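(* Let $\mathcal{F}$ be a regular thin family and $X$ a Banach space. Then every bounded $\mathcal{F}$-sequence in $X$ admits an $\mathcal{F}$-spreading model. In particular, for every bounded $\mathcal{F}$-sequence $(x_s)_{s\in\mathcal{F}}$ in $X$ and every $N\in[\mathbb{N}]^\infty$ there exists $M\in[N]^\infty$ such that $(x_s)_{s\in\mathcal{F}\upharpoonright M}$ generates an $\mathcal{F}$-spreading model.
   Context: $\mathbb{N}=\{1,2,\dots\}$. For $M\subseteq\mathbb{N}$, $[M]^{<\infty}$ and $[M]^\infty$ denote the sets of finite, respectively infinite, subsets of $M$. For $s\subseteq\mathbb{N}$, $s(k)$ is the $k$-th element of $s$ in increasing order and $|s|$ its cardinality. $t\sqsubseteq s$ means that $t$ is an initial segment of $s$. For $\mathcal{F}\subseteq[\mathbb{N}]^{<\infty}$, $\mathcal{F}\upharpoonright M=\mathcal{F}\cap[M]^{<\infty}$ and $\widehat{\mathcal{F}}=\{t\in[\mathbb{N}]^{<\infty}:\exists s\in\mathcal{F},\ t\sqsubseteq s\}$. A nonempty family $\mathcal{R}\subseteq[\mathbb{N}]^{<\infty}$ is regular if it is hereditary (closed under subsets), spreading (if $\{n_1<\dots<n_k\}\in\mathcal{R}$, $m_1<\dots<m_k$ and $n_i\leq m_i$ for all $i$, then $\{m_1,\dots,m_k\}\in\mathcal{R}$) and compact (the set of characteristic functions of its members is closed in $\{0,1\}^{\mathbb{N}}$). $\mathcal{F}$ is thin if no element of $\mathcal{F}$ is a proper initial segment of another one. $\mathcal{F}$ is regular thin if it is thin and $\widehat{\mathcal{F}}$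 is regular. A tuple $(s_j)_{j=1}^k$ of nonempty finite subsets of $\mathbb{N}$ is a plegma family if (i) $s_i(m)<s_j(m)$ whenever $i<j$ and $m\leq\min(|s_i|,|s_j|)$; and (ii) for all $i,j$, $s_i(m)<s_j(m+1)$ whenever $m\leq\min(|s_i|,|s_j|-1)$. $\mathrm{Plm}_k(\mathcal{F})$ is the set of all plegma families $(s_j)_{j=1}^k$ with all $s_j\in\mathcal{F}$. An $\mathcal{F}$-sequence in $X$ is a map $\mathcal{F}\to X$, written $(x_s)_{s\in\mathcal{F}}$; it is bounded if $\sup_s\|x_s\|<\infty$. Let $(E,\|\cdot\|_* )$ be an infinite dimensional seminormed linear space with Hamel basis $(e_n)_n$, and $M\in[\mathbb{N}]^\infty$. The $\mathcal{F}$-subsequence $(x_s)_{s\in\mathcal{F}\upharpoonright M}$ generates $(e_n)_n$ as an $\mathcal{F}$-spreading model if there is a null sequence $(\delta_n)_n$ of positive reals such that for all $l\in\mathbb{N}$, $1\leq k\leq l$, $a_1,\dots,a_k\in[-1,1]$ and $(s_j)_{j=1}^k\in\mathrm{Plm}_k(\mathcal{F}\upharpoonright M)$ with $s_1(1)\geq M(l)$, $$\Big|\,\Big\|\sum_{j=1}^ka_jx_{s_j}\Big\|-\Big\|\sum_{j=1}^ka_je_j\Big\|_*\Big|\leq\delta_l.$$ $(x_s)_{s\in\mathcal{F}}$ admits $(e_n)_n$ as an $\mathcal{F}$-spreading model if $(x_s)_{s\in\mathcal{F}\upharpoonright M}$ generates $(e_n)_n$ for some $M\in[\mathbb{N}]^\infty$.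 *)

theory Defs
  imports "HOL-Analysis.Analysis" "HOL-Analysis.Finite_Function_Topology"
begin

text \<open>
  The positive integers are the subset \<open>{1..}\<close> of \<^typ>\<open>nat\<close>; all indices below start at 1.
  The set of finite subsets of \<open>M\<close> is \<^term>\<open>Fpow M\<close>.
\<close>

abbreviation PosNat :: "nat set" where
  "PosNat \<equiv> {1..}"

definition inf_subsets :: "nat set \<Rightarrow> nat set set" where
  "inf_subsets M = {L. L \<subseteq> M \<and> infinite L}"

text \<open>
  \<open>elt s k\<close> is the \<open>k\<close>-th element of \<open>s\<close> in increasing order. It is meaningful for \<open>k \<ge> 1\<close>
  and, when \<open>s\<close> is finite, \<open>k \<le> card s\<close>; it is only used in this range.
\<close>

definition elt :: "nat set \<Rightarrow> nat \<Rightarrow> nat" where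
  "elt s k = enumerate s (k - 1)"

definition init_seg :: "nat set \<Rightarrow> nat set \<Rightarrow> bool" where
  "init_seg t s \<longleftrightarrow> t \<subseteq> s \<and> (\<forall>x\<in>t. \<forall>y\<in>s. y \<le> x \<longrightarrow> y \<in> t)"

definition restrict_family :: "nat set set \<Rightarrow> nat set \<Rightarrow> nat set set" where
  "restrict_family F M = F \<inter> Fpow M"

definition init_closure :: "nat set set \<Rightarrow> nat set set" where
  "init_closure F = {t \<in> Fpow PosNat. \<exists>s\<in>F. init_seg t s}"

definition hereditary :: "nat set set \<Rightarrow> bool" where
  "hereditary R \<longleftrightarrow> (\<forall>s\<in>R. \<forall>t. t \<subseteq> s \<longrightarrow> t \<in> R)"

definition spreading :: "nat set set \<Rightarrow> bool" where
  "spreading R \<longleftrightarrow>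
     (\<forall>s\<in>R. \<forall>t\<in>Fpow PosNat.
        card t = card s \<and> (\<forall>i\<in>{1..card s}. elt s i \<le> elt t i) \<longrightarrow> t \<in> R)"

text \<open>
  Characteristic functions live in \<^typ>\<open>nat \<Rightarrow> bool\<close> with the product of the discrete topologies.
  For families of subsets of \<open>{1..}\<close> the coordinate 0 is constantly \<^const>\<open>False\<close>, so being closed
  here is the same as being closed in the product over \<open>{1..}\<close>.
\<close>

definition compact_family :: "nat set set \<Rightarrow> bool" where
  "compact_family R \<longleftrightarrow> closed ((\<lambda>s. (\<lambda>n. n \<in> s)) ` R)"

definition regular_family :: "nat set set \<Rightarrow> bool" where
  "regular_family R \<longleftrightarrow>
     R \<noteq> {} \<and> R \<subseteq> Fpow PosNat \<and> hereditary R \<and> spreading R \<and> compact_family R"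

definition thin :: "nat set set \<Rightarrow> bool" where
  "thin F \<longleftrightarrow> (\<forall>s\<in>F. \<forall>t\<in>F. init_seg t s \<longrightarrow> t = s)"

definition regular_thin :: "nat set set \<Rightarrow> bool" where
  "regular_thin F \<longleftrightarrow> F \<subseteq> Fpow PosNat \<and> thin F \<and> regular_family (init_closure F)"

definition plegma :: "nat \<Rightarrow> (nat \<Rightarrow> nat set) \<Rightarrow> bool" where
  "plegma k s \<longleftrightarrow>
     (\<forall>j\<in>{1..k}. s j \<in> Fpow PosNat \<and> s j \<noteq> {}) \<and>
     (\<forall>i\<in>{1..k}. \<forall>j\<in>{1..k}. i < j \<longrightarrow>
        (\<forall>m\<in>{1..min (card (s i)) (card (s j))}. elt (s i) m < elt (s j) m)) \<and>
     (\<forall>i\<in>{1..k}. \<forall>j\<in>{1..k}.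
        (\<forall>m\<in>{1..min (card (s i)) (card (s j) - 1)}. elt (s i) m < elt (s j) (m + 1)))"

definition Plm :: "nat \<Rightarrow> nat set set \<Rightarrow> (nat \<Rightarrow> nat set) set" where
  "Plm k F = {s \<in> {1..k} \<rightarrow>\<^sub>E F. plegma k s}"

definition seminorm :: "('e::real_vector \<Rightarrow> real) \<Rightarrow> bool" where
  "seminorm p \<longleftrightarrow>
     (\<forall>x y. p (x + y) \<le> p x + p y) \<and> (\<forall>c x. p (c *\<^sub>R x) = \<bar>c\<bar> * p x)"

text \<open>Only the values \<open>e n\<close> with \<open>n \<ge> 1\<close> matter.\<close>

definition hamel_basis :: "(nat \<Rightarrow> 'e::real_vector) \<Rightarrow> bool" where
  "hamel_basis e \<longleftrightarrow>
     inj_on e PosNat \<and> independent (e ` PosNat) \<and> span (e ` PosNat) = UNIV"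

text \<open>
  The linear space \<open>E\<close> is the whole type \<open>'e\<close>. Its infinite dimensionality
  is implied by \<^const>\<open>hamel_basis\<close>, the basis being indexed injectively by \<open>{1..}\<close>.
\<close>

definition generates ::
  "nat set set \<Rightarrow> (nat set \<Rightarrow> 'a::real_normed_vector) \<Rightarrow> nat set \<Rightarrow>
     ('e::real_vector \<Rightarrow> real) \<Rightarrow> (nat \<Rightarrow> 'e) \<Rightarrow> bool" where
  "generates F x M p e \<longleftrightarrow>
     seminorm p \<and> hamel_basis e \<and>
     (\<exists>\<delta>::nat \<Rightarrow> real. (\<forall>n. \<delta> n > 0) \<and> \<delta> \<longlonglongrightarrow> 0 \<and>
        (\<forall>l k. \<forall>a::nat \<Rightarrow> real. \<forall>s.
           1 \<le> k \<and> k \<le> l \<and> (\<forall>j\<in>{1..k}. a j \<in> {-1..1}) \<and>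
           s \<in> Plm k (restrict_family F M) \<and> elt (s 1) 1 \<ge> elt M l \<longrightarrow>
           \<bar>norm (\<Sum>j=1..k. a j *\<^sub>R x (s j)) - p (\<Sum>j=1..k. a j *\<^sub>R e j)\<bar> \<le> \<delta> l))"

definition admits ::
  "nat set set \<Rightarrow> (nat set \<Rightarrow> 'a::real_normed_vector) \<Rightarrow>
     ('e::real_vector \<Rightarrow> real) \<Rightarrow> (nat \<Rightarrow> 'e) \<Rightarrow> bool" where
  "admits F x p e \<longleftrightarrow> (\<exists>M\<in>inf_subsets PosNat. generates F x M p e)"

text \<open>
  Existence of a spreading model quantifies over the linear space \<open>E\<close>, hence over types. A space
  with a Hamel basis indexed by \<open>{1..}\<close> is linearly isomorphic to the space
  \<^typ>\<open>nat \<Rightarrow>\<^sub>0 real\<close> of finitely supported sequences, and seminorm and basis can be transported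
  along the isomorphism; so it suffices to let the seminorm and the basis vary over this one space.
\<close>

definition generates_some_spreading_model ::
  "nat set set \<Rightarrow> (nat set \<Rightarrow> 'a::real_normed_vector) \<Rightarrow> nat set \<Rightarrow> bool" where
  "generates_some_spreading_model F x M \<longleftrightarrow>
     (\<exists>(p :: (nat \<Rightarrow>\<^sub>0 real) \<Rightarrow> real) (e :: nat \<Rightarrow> (nat \<Rightarrow>\<^sub>0 real)). generates F x M p e)"

definition admits_some_spreading_model ::
  "nat set set \<Rightarrow> (nat set \<Rightarrow> 'a::real_normed_vector) \<Rightarrow> bool" where
  "admits_some_spreading_model F x \<longleftrightarrow>
     (\<exists>(p :: (nat \<Rightarrow>\<^sub>0 real) \<Rightarrow> real) (e :: nat \<Rightarrow> (nat \<Rightarrow>\<^sub>0 real)). admits F x p e)"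

end

theory Submission
  imports Defs
begin

text \<open>
  The engine is a Ramsey theorem for plegma tuples of a thin family: every colouring of
  \<open>Plm k F\<close> with finitely many colours is constant on the tuples inside a suitable infinite set
  (\<open>dense_open_plegma_homogeneous\<close>). A plegma tuple enumerates its union in lexicographic
  order of (position in the set, index of the set), and thinness says when each set of the tuple
  stops. Hence at most one tuple of length \<open>k\<close> has a union that is an initial segment of a given infinite set
  (\<open>plegma_union_determines\<close>). So a colour class is a family of finite sets, the unions, to which
  Galvin's dichotomy applies: inside some infinite \<open>L\<close>, either no member occurs, or every infinite
  subset of \<open>L\<close> starts with one. In the second case every plegma tuple in \<open>L\<close> has the
  colour: prolong its union to an infinite subset of \<open>L\<close> and use uniqueness.

  Colouring a tuple by the approximate norm of \<open>\<Sum>j. a j *\<^sub>R x (s j)\<close>, for all \<open>a\<close> in a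
  finite net of the cube, shows that these norms can be made to vary with \<open>s\<close> by at most any
  given \<open>\<epsilon> > 0\<close>, uniformly in \<open>a\<close> (\<open>dense_open_stable\<close>). A diagonal argument
  gives one infinite \<open>M\<close> whose tail from its \<open>l\<close>-th element on is stable up to
  \<open>1/l\<close> for tuples of length at most \<open>l\<close>. Pick a tuple of each length, further and
  further out in \<open>M\<close>. The norms along these tuples form a Cauchy sequence for each finitely
  supported vector, and their limit is the seminorm of the spreading model
  (\<open>generates_from_stable\<close>).

  Such tuples exist by Galvin's dichotomy for the family itself, which comes first. Unless the
  infinite set \<open>L\<close> that it provides contains no nonempty member of the family, every infinite
  subset of \<open>L\<close> starts with a nonempty member, and interleaved infinite subsets then start with the sets of a plegma tuple
  (\<open>plegma_exists\<close>). In the exceptional case the condition on the spreading model is void.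
\<close>

section \<open>Dense open properties of infinite sets\<close>

text \<open>
  The properties below are the open dense ones of the order of infinite sets under inclusion: they
  pass to infinite subsets and can always be reached by shrinking. Every thinning argument is
  phrased through them, so that the passage to a diagonal set is made only once.
\<close>

definition dense_open :: "(nat set \<Rightarrow> bool) \<Rightarrow> bool" where
  "dense_open P \<longleftrightarrow> (\<forall>A B. infinite B \<longrightarrow> B \<subseteq> A \<longrightarrow> P A \<longrightarrow> P B) \<and>
     (\<forall>A. infinite A \<longrightarrow> (\<exists>B\<subseteq>A. infinite B \<and> P B))"

lemma dense_openI:
  assumes "\<And>A B. \<lbrakk>infinite B; B \<subseteq> A; P A\<rbrakk> \<Longrightarrow> P B"
    and "\<And>A. infinite A \<Longrightarrow> \<exists>B\<subseteq>A. infinite B \<and> P B"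
  shows "dense_open P"
  using assms unfolding dense_open_def by metis

lemma dense_open_mono: "\<lbrakk>dense_open P; infinite B; B \<subseteq> A; P A\<rbrakk> \<Longrightarrow> P B"
  unfolding dense_open_def by metis

lemma dense_open_ex:
  assumes "dense_open P" "infinite A"
  obtains B where "B \<subseteq> A" "infinite B" "P B"
  using assms unfolding dense_open_def by metis

lemma dense_open_finite_Ball:
  assumes "finite I" "\<And>i. i \<in> I \<Longrightarrow> dense_open (P i)"
  shows "dense_open (\<lambda>A. \<forall>i\<in>I. P i A)"
  using assms
proof (induction I rule: finite_induct)
  case empty
  show ?case by (auto simp: dense_open_def)
next
  case (insert i I)
  have i: "dense_open (P i)" and I: "dense_open (\<lambda>A. \<forall>i\<in>I. P i A)"
    using insert by auto
  show ?case
  proof (rule dense_openI)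
    fix A B assume "infinite B" "B \<subseteq> A" "\<forall>i\<in>insert i I. P i A"
    then show "\<forall>i\<in>insert i I. P i B"
      using dense_open_mono[OF i] dense_open_mono[OF I] by (metis insert_iff)
  next
    fix A :: "nat set" assume "infinite A"
    then obtain B where B: "B \<subseteq> A" "infinite B" "P i B" by (rule dense_open_ex[OF i])
    obtain C where C: "C \<subseteq> B" "infinite C" "\<forall>i\<in>I. P i C"
      by (rule dense_open_ex[OF I B(2)])
    then have "P i C" using dense_open_mono[OF i] B by metis
    with B C show "\<exists>C\<subseteq>A. infinite C \<and> (\<forall>i\<in>insert i I. P i C)" by (metis insert_iff order_trans)
  qed
qed

text \<open>
  Shrink repeatedly, discarding at each step everything up to the least element \<open>n\<close> and then
  making \<open>P n\<close> true; the least elements form \<open>L\<close>, and the rest of \<open>L\<close> beyond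
  \<open>n\<close> lies in the set chosen for \<open>n\<close>.
\<close>

lemma dense_open_diagonal:
  assumes P: "\<And>n. dense_open (P n)" and A: "infinite A"
  obtains L where "L \<subseteq> A" "infinite L" "\<And>n. n \<in> L \<Longrightarrow> P n (L \<inter> {n<..})"
proof -
  define m :: "nat set \<Rightarrow> nat" where "m = (\<lambda>B. LEAST n. n \<in> B)"
  have "\<exists>f. \<forall>n. (infinite (f n) \<and> f n \<subseteq> A) \<and>
          (f (Suc n) \<subseteq> f n \<inter> {m (f n)<..} \<and> P (m (f n)) (f (Suc n)))"
  proof (rule dependent_nat_choice)
    show "\<exists>B. infinite B \<and> B \<subseteq> A" using A by blast
  next
    fix B :: "nat set" and n :: nat
    assume B: "infinite B \<and> B \<subseteq> A"
    have "B \<inter> {m B<..} = B - {..m B}" by auto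
    then have "infinite (B \<inter> {m B<..})" using B by simp
    then obtain C where "C \<subseteq> B \<inter> {m B<..}" "infinite C" "P (m B) C"
      by (rule dense_open_ex[OF P])
    then show "\<exists>C. (infinite C \<and> C \<subseteq> A) \<and> (C \<subseteq> B \<inter> {m B<..} \<and> P (m B) C)"
      using B by blast
  qed
  then obtain f where f: "\<And>n. infinite (f n)" "\<And>n. f n \<subseteq> A"
      "\<And>n. f (Suc n) \<subseteq> f n \<inter> {m (f n)<..}" "\<And>n. P (m (f n)) (f (Suc n))"
    by blast
  have dec: "f j \<subseteq> f i" if "i \<le> j" for i j
    using lift_Suc_antimono_le[of f i j] f(3) that by blast
  have mem: "m (f n) \<in> f n" for n
    unfolding m_def using f(1)[of n] by (metis LeastI_ex finite.emptyI ex_in_conv)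
  have "m (f n) < m (f (Suc n))" for n using mem[of "Suc n"] f(3)[of n] by auto
  then have sm: "strict_mono (\<lambda>n. m (f n))" by (simp add: strict_mono_Suc_iff)
  define L where "L = range (\<lambda>n. m (f n))"
  have inf: "infinite L"
    unfolding L_def using sm by (meson range_inj_infinite strict_mono_imp_inj_on)
  show thesis
  proof (rule that[of L])
    show "L \<subseteq> A" unfolding L_def using mem f(2) by blast
    show "infinite L" by (rule inf)
    fix x assume "x \<in> L"
    then obtain n where n: "x = m (f n)" unfolding L_def by blast
    have "L \<inter> {x<..} \<subseteq> f (Suc n)"
    proof
      fix y assume "y \<in> L \<inter> {x<..}"
      then obtain j where j: "y = m (f j)" "m (f n) < m (f j)" unfolding L_def n by blast
      then have "n < j" using strict_mono_less[OF sm] by blast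
      then show "y \<in> f (Suc n)" using dec[of "Suc n" j] mem j by auto
    qed
    moreover have "L \<inter> {x<..} = L - {..x}" by auto
    then have "infinite (L \<inter> {x<..})" using inf by simp
    ultimately show "P x (L \<inter> {x<..})"
      using dense_open_mono[OF P] f(4) n by blast
  qed
qed

lemma infinite_Int_greaterThan: "infinite (A :: nat set) \<Longrightarrow> infinite (A \<inter> {n<..})"
proof -
  have "A \<inter> {n<..} = A - {..n}" by auto
  then show "infinite A \<Longrightarrow> ?thesis" by simp
qed

section \<open>Galvin's dichotomy\<close>

text \<open>
  Combinatorial forcing for a family \<open>G\<close> of finite sets: \<open>A\<close> accepts \<open>t\<close> if all
  prolongations of \<open>t\<close> by elements of \<open>A\<close> start with a member of \<open>G\<close>, which may be
  shorter than \<open>t\<close>. Rejection means that no shrinking of \<open>A\<close> can achieve acceptance.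
\<close>

definition accepts :: "nat set set \<Rightarrow> nat set \<Rightarrow> nat set \<Rightarrow> bool" where
  "accepts G A t \<longleftrightarrow> (\<forall>B\<subseteq>A. infinite B \<longrightarrow> (\<forall>x\<in>t. \<forall>y\<in>B. x < y) \<longrightarrow>
     (\<exists>s\<in>G. init_seg s (t \<union> B)))"

definition rejects :: "nat set set \<Rightarrow> nat set \<Rightarrow> nat set \<Rightarrow> bool" where
  "rejects G A t \<longleftrightarrow> (\<forall>B\<subseteq>A. infinite B \<longrightarrow> \<not> accepts G B t)"

lemma accepts_subset: "\<lbrakk>accepts G A t; B \<subseteq> A\<rbrakk> \<Longrightarrow> accepts G B t"
  unfolding accepts_def by (meson order_trans)

lemma rejects_subset: "\<lbrakk>rejects G A t; B \<subseteq> A\<rbrakk> \<Longrightarrow> rejects G B t"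
  unfolding rejects_def by (meson order_trans)

text \<open>
  Only elements of \<open>A\<close> beyond \<open>t\<close> matter, so properties obtained for the tails of a
  diagonal set transfer to the whole set.
\<close>

lemma accepts_tail:
  assumes "accepts G (A \<inter> {n<..}) t" "n \<in> t"
  shows "accepts G A t"
  unfolding accepts_def
proof (intro allI impI)
  fix B assume "B \<subseteq> A" "infinite B" "\<forall>x\<in>t. \<forall>y\<in>B. x < y"
  moreover from this have "B \<subseteq> A \<inter> {n<..}" using assms(2) by auto
  ultimately show "\<exists>s\<in>G. init_seg s (t \<union> B)" using assms(1) unfolding accepts_def by blast
qed

lemma rejects_tail:
  assumes "rejects G (A \<inter> {n<..}) t"
  shows "rejects G A t"
  unfolding rejects_def
proof (intro allI impI notI)
  fix B assume B: "B \<subseteq> A" "infinite B" "accepts G B t"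
  then have "accepts G (B \<inter> {n<..}) t" by (simp add: accepts_subset)
  moreover have "B \<inter> {n<..} \<subseteq> A \<inter> {n<..}" using B by auto
  ultimately show False
    using assms infinite_Int_greaterThan[OF B(2)] unfolding rejects_def by blast
qed

lemma dense_open_decides: "dense_open (\<lambda>A. accepts G A t \<or> rejects G A t)"
proof (rule dense_openI)
  fix A B assume "B \<subseteq> A" "accepts G A t \<or> rejects G A t"
  then show "accepts G B t \<or> rejects G B t" by (meson accepts_subset rejects_subset)
next
  fix A :: "nat set" assume "infinite A"
  then show "\<exists>B\<subseteq>A. infinite B \<and> (accepts G B t \<or> rejects G B t)"
    unfolding rejects_def by blast
qed

text \<open>
  If \<open>t\<close> is rejected and one-point prolongations are decided, then only finitely many of these
  are accepted: infinitely many accepted points would form a set that accepts \<open>t\<close>, because a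
  prolongation of \<open>t\<close> by such points is a prolongation of \<open>insert m t\<close> by its least new
  element \<open>m\<close>. The finitely many exceptions are removed.
\<close>

lemma dense_open_rejection_propagates:
  "dense_open (\<lambda>A. accepts G A t \<or>
     rejects G A t \<and> (\<forall>m\<in>A. (\<forall>x\<in>t. x < m) \<longrightarrow> rejects G A (insert m t)))"
proof (rule dense_openI)
  fix A B
  assume "B \<subseteq> A" and A: "accepts G A t \<or>
     rejects G A t \<and> (\<forall>m\<in>A. (\<forall>x\<in>t. x < m) \<longrightarrow> rejects G A (insert m t))"
  then show "accepts G B t \<or>
     rejects G B t \<and> (\<forall>m\<in>B. (\<forall>x\<in>t. x < m) \<longrightarrow> rejects G B (insert m t))"
    by (meson accepts_subset rejects_subset subsetD)
next
  fix A :: "nat set" assume A: "infinite A"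
  show "\<exists>B\<subseteq>A. infinite B \<and> (accepts G B t \<or>
     rejects G B t \<and> (\<forall>m\<in>B. (\<forall>x\<in>t. x < m) \<longrightarrow> rejects G B (insert m t)))"
  proof (cases "\<exists>B\<subseteq>A. infinite B \<and> accepts G B t")
    case True
    then show ?thesis by blast
  next
    case False
    then have rej: "rejects G A t" unfolding rejects_def by blast
    obtain C where C: "C \<subseteq> A" "infinite C"
      and dec: "\<And>m. m \<in> C \<Longrightarrow> accepts G (C \<inter> {m<..}) (insert m t) \<or>
                  rejects G (C \<inter> {m<..}) (insert m t)"
      using dense_open_diagonal[of "\<lambda>m A. accepts G A (insert m t) \<or> rejects G A (insert m t)",
          OF dense_open_decides A] by blast
    have dec: "accepts G C (insert m t) \<or> rejects G C (insert m t)" if "m \<in> C" for m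
      using dec[OF that] accepts_tail rejects_tail by blast
    define D where "D = {m \<in> C. accepts G C (insert m t)}"
    have "finite D"
    proof (rule ccontr)
      assume D: "infinite D"
      have "accepts G D t"
        unfolding accepts_def
      proof (intro allI impI)
        fix B assume B: "B \<subseteq> D" "infinite B" "\<forall>x\<in>t. \<forall>y\<in>B. x < y"
        define m where "m = (LEAST n. n \<in> B)"
        have m: "m \<in> B" unfolding m_def using B(2) by (metis LeastI_ex finite.emptyI ex_in_conv)
        have le: "m \<le> y" if "y \<in> B" for y unfolding m_def using that by (rule Least_le)
        have "accepts G C (insert m t)" using m B(1) unfolding D_def by blast
        moreover have "B - {m} \<subseteq> C" using B(1) unfolding D_def by blast
        moreover have "\<forall>x\<in>insert m t. \<forall>y\<in>B - {m}. x < y"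
          using B(3) le by (auto simp: order_less_le)
        ultimately have "\<exists>s\<in>G. init_seg s (insert m t \<union> (B - {m}))"
          unfolding accepts_def using B(2) by (meson infinite_remove)
        moreover have "insert m t \<union> (B - {m}) = t \<union> B" using m by auto
        ultimately show "\<exists>s\<in>G. init_seg s (t \<union> B)" by simp
      qed
      moreover have "D \<subseteq> A" using C unfolding D_def by blast
      ultimately show False using False D by blast
    qed
    then have "infinite (C - D)" using C(2) by simp
    moreover have "C - D \<subseteq> A" using C(1) by blast
    moreover have "rejects G (C - D) t" using rejects_subset[OF rej] C(1) by blast
    moreover have "rejects G (C - D) (insert m t)" if "m \<in> C - D" for m
      using dec[of m] that rejects_subset[of G C "insert m t" "C - D"] unfolding D_def by blast
    ultimately show ?thesis by blast
  qed
qed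

text \<open>
  On a diagonal set either the empty set is accepted, which is the second alternative, or rejection
  propagates from the empty set to all finite subsets. A member of \<open>G\<close> is always accepted, so then
  none of them can be a subset.
\<close>

lemma galvin_dichotomy:
  assumes N: "infinite N"
  obtains L where "L \<subseteq> N" "infinite L"
    "(\<forall>s\<in>G. finite s \<longrightarrow> \<not> s \<subseteq> L) \<or> (\<forall>A\<subseteq>L. infinite A \<longrightarrow> (\<exists>s\<in>G. init_seg s A))"
proof -
  define P where "P = (\<lambda>t A. accepts G A t \<or>
     rejects G A t \<and> (\<forall>m\<in>A. (\<forall>x\<in>t. x < m) \<longrightarrow> rejects G A (insert m t)))"
  have P: "dense_open (P t)" for t
    unfolding P_def by (rule dense_open_rejection_propagates)
  obtain N' where N': "N' \<subseteq> N" "infinite N'" "P {} N'"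
    by (rule dense_open_ex[OF P N])
  have "dense_open (\<lambda>A. \<forall>t\<in>Pow {..n}. P t A)" for n
    by (rule dense_open_finite_Ball) (auto intro: P)
  then obtain L where L: "L \<subseteq> N'" "infinite L"
    and diag: "\<And>n. n \<in> L \<Longrightarrow> \<forall>t\<in>Pow {..n}. P t (L \<inter> {n<..})"
    using dense_open_diagonal[of "\<lambda>n A. \<forall>t\<in>Pow {..n}. P t A", OF _ N'(2)] by blast
  have P0: "P {} L" using dense_open_mono[OF P L(2,1) N'(3)] .
  show thesis
  proof (cases "accepts G L {}")
    case True
    then have "\<forall>A\<subseteq>L. infinite A \<longrightarrow> (\<exists>s\<in>G. init_seg s A)" unfolding accepts_def by simp
    then show thesis using that[of L] L N' by blast
  next
    case False
    have rej: "rejects G L t" if "finite t" "t \<subseteq> L" for t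
      using that
    proof (induction t rule: finite_linorder_max_induct)
      case empty
      show ?case using P0 False unfolding P_def by blast
    next
      case (insert m t)
      show ?case
      proof (cases "t = {}")
        case True
        then show ?thesis using P0 False insert.prems unfolding P_def by auto
      next
        case False
        define n where "n = Max t"
        have n: "n \<in> t" "t \<subseteq> {..n}" unfolding n_def using False insert.hyps by auto
        have "P t (L \<inter> {n<..})" using diag[of n] n insert.prems by auto
        moreover have "rejects G L t" using insert by auto
        then have "\<not> accepts G (L \<inter> {n<..}) t"
          unfolding rejects_def using infinite_Int_greaterThan[OF L(2)] by blast
        ultimately have "rejects G (L \<inter> {n<..}) (insert m t)"
          unfolding P_def using insert n by auto
        then show ?thesis by (rule rejects_tail)
      qed
    qed
    have "\<not> s \<subseteq> L" if s: "s \<in> G" "finite s" for s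
    proof
      assume "s \<subseteq> L"
      then have "\<not> accepts G L s" using rej[of s] s L(2) unfolding rejects_def by blast
      moreover have "init_seg s (s \<union> B)" if "\<forall>x\<in>s. \<forall>y\<in>B. x < y" for B
        using that unfolding init_seg_def by (auto dest: leD)
      then have "accepts G L s" unfolding accepts_def using s by blast
      ultimately show False by blast
    qed
    then show thesis using that[of L] L N' by blast
  qed
qed

section \<open>Plegma tuples as lexicographic enumerations\<close>

definition rank :: "nat set \<Rightarrow> nat \<Rightarrow> nat" where
  "rank s x = card (s \<inter> {..<x})"

lemma rank_elt:
  assumes "finite s" "m \<in> {1..card s}"
  shows "elt s m \<in> s" "rank s (elt s m) = m - 1"
proof -
  have m: "m - 1 < card s" using assms by auto
  show "elt s m \<in> s" unfolding elt_def by (rule finite_enumerate_in_set[OF assms(1) m])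
  have bij: "bij_betw (enumerate s) {..<card s} s" by (rule finite_bij_enumerate[OF assms(1)])
  have "s \<inter> {..<enumerate s (m - 1)} = enumerate s ` {..<m - 1}"
  proof
    show "enumerate s ` {..<m - 1} \<subseteq> s \<inter> {..<enumerate s (m - 1)}"
      using m assms(1) by (auto intro!: finite_enumerate_in_set)
  next
    show "s \<inter> {..<enumerate s (m - 1)} \<subseteq> enumerate s ` {..<m - 1}"
    proof
      fix x assume x: "x \<in> s \<inter> {..<enumerate s (m - 1)}"
      then obtain n where n: "n < card s" "enumerate s n = x"
        using finite_enumerate_Ex[OF assms(1)] by blast
      then have "n < m - 1" using x finite_enumerate_mono_iff[OF assms(1) n(1) m] by auto
      then show "x \<in> enumerate s ` {..<m - 1}" using n by auto
    qed
  qed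
  moreover have "inj_on (enumerate s) {..<m - 1}"
    using bij m by (auto simp: bij_betw_def intro: inj_on_subset)
  ultimately show "rank s (elt s m) = m - 1"
    unfolding rank_def elt_def by (simp add: card_image)
qed

lemma elt_rank:
  assumes "finite s" "x \<in> s"
  shows "elt s (Suc (rank s x)) = x" "Suc (rank s x) \<in> {1..card s}"
proof -
  obtain n where n: "n < card s" "enumerate s n = x"
    using finite_enumerate_Ex[OF assms] by blast
  then have "Suc n \<in> {1..card s}" "elt s (Suc n) = x" by (auto simp: elt_def)
  moreover from this have "rank s x = n" using rank_elt(2)[OF assms(1), of "Suc n"] by simp
  ultimately show "elt s (Suc (rank s x)) = x" "Suc (rank s x) \<in> {1..card s}" by auto
qed

text \<open>
  The two interlacing conditions of a plegma tuple together say that its elements increase with the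
  lexicographic order of the pair (rank in its set, index of its set). In this form sets of
  different cardinalities need no separate treatment.
\<close>

lemma plegma_iff_lex:
  "plegma k s \<longleftrightarrow> (\<forall>j\<in>{1..k}. s j \<in> Fpow PosNat \<and> s j \<noteq> {}) \<and>
     (\<forall>i\<in>{1..k}. \<forall>j\<in>{1..k}. \<forall>x\<in>s i. \<forall>y\<in>s j.
        rank (s i) x < rank (s j) y \<or> rank (s i) x = rank (s j) y \<and> i < j \<longrightarrow> x < y)"
  (is "_ \<longleftrightarrow> ?N \<and> ?L")
proof
  assume pl: "plegma k s"
  then have N: ?N by (simp add: plegma_def)
  then have fin: "finite (s j)" if "j \<in> {1..k}" for j using that by (auto simp: Fpow_def)
  have ?L
  proof (intro ballI impI)
    fix i j x y
    assume ij: "i \<in> {1..k}" "j \<in> {1..k}" and x: "x \<in> s i" and y: "y \<in> s j"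
      and lex: "rank (s i) x < rank (s j) y \<or> rank (s i) x = rank (s j) y \<and> i < j"
    define m where "m = Suc (rank (s i) x)"
    define n where "n = Suc (rank (s j) y)"
    have m: "elt (s i) m = x" "m \<in> {1..card (s i)}"
      unfolding m_def using elt_rank[OF fin[OF ij(1)] x] by auto
    have n: "elt (s j) n = y" "n \<in> {1..card (s j)}"
      unfolding n_def using elt_rank[OF fin[OF ij(2)] y] by auto
    have "m < n \<or> m = n \<and> i < j" using lex unfolding m_def n_def by auto
    then show "x < y"
    proof
      assume "m < n"
      then have mn: "m \<in> {1..min (card (s i)) (card (s j) - 1)}" using m n by auto
      then have "x < elt (s j) (m + 1)" using pl ij m(1) unfolding plegma_def by blast
      also have "elt (s j) (m + 1) \<le> elt (s j) n"
      proof (cases "m + 1 = n")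
        case False
        then have "elt (s j) (m + 1) < elt (s j) n"
          unfolding elt_def using \<open>m < n\<close> n(2) m(2)
          by (intro finite_enumerate_mono fin ij) auto
        then show ?thesis by simp
      qed simp
      finally show "x < y" using n by simp
    next
      assume "m = n \<and> i < j"
      moreover from this have "m \<in> {1..min (card (s i)) (card (s j))}" using m n by auto
      ultimately have "elt (s i) m < elt (s j) m" using pl ij unfolding plegma_def by blast
      then show "x < y" using m(1) n(1) \<open>m = n \<and> i < j\<close> by simp
    qed
  qed
  with N show "?N \<and> ?L" by blast
next
  assume R: "?N \<and> ?L"
  then have fin: "finite (s j)" if "j \<in> {1..k}" for j using that by (auto simp: Fpow_def)
  have L: "x < y" if "i \<in> {1..k}" "j \<in> {1..k}" "x \<in> s i" "y \<in> s j"
    "rank (s i) x < rank (s j) y \<or> rank (s i) x = rank (s j) y \<and> i < j" for i j x y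
    using R that by blast
  show "plegma k s"
    unfolding plegma_def
  proof (intro conjI ballI impI)
    fix i j m assume ij: "i \<in> {1..k}" "j \<in> {1..k}" "i < j"
      and m: "m \<in> {1..min (card (s i)) (card (s j))}"
    show "elt (s i) m < elt (s j) m"
      using ij m by (intro L[of i j]) (auto simp: rank_elt fin)
  next
    fix i j m assume ij: "i \<in> {1..k}" "j \<in> {1..k}"
      and m: "m \<in> {1..min (card (s i)) (card (s j) - 1)}"
    then have m': "m \<in> {1..card (s i)}" "m + 1 \<in> {1..card (s j)}" by auto
    have "rank (s i) (elt (s i) m) < rank (s j) (elt (s j) (m + 1))"
      using rank_elt(2)[OF fin[OF ij(1)] m'(1)] rank_elt(2)[OF fin[OF ij(2)] m'(2)] m by auto
    then show "elt (s i) m < elt (s j) (m + 1)"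
      using ij L[of i j] rank_elt(1)[OF fin[OF ij(1)] m'(1)] rank_elt(1)[OF fin[OF ij(2)] m'(2)]
      by blast
  qed (use R in auto)
qed

lemma plegma_lex:
  assumes "plegma k s" "i \<in> {1..k}" "j \<in> {1..k}" "x \<in> s i" "y \<in> s j"
    and "rank (s i) x < rank (s j) y \<or> rank (s i) x = rank (s j) y \<and> i < j"
  shows "x < y"
  using assms unfolding plegma_iff_lex by blast

lemma plegma_disjoint:
  assumes pl: "plegma k s" and ij: "i \<in> {1..k}" "j \<in> {1..k}" and x: "x \<in> s i" "x \<in> s j"
  shows "i = j"
  using plegma_lex[OF pl ij x] plegma_lex[OF pl ij(2,1) x(2,1)]
  by (metis less_irrefl nat_neq_iff)

lemma plegma_first_least:
  assumes pl: "plegma k s" and j: "j \<in> {1..k}" and x: "x \<in> s j"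
  shows "elt (s 1) 1 \<le> x"
proof -
  have 1: "1 \<in> {1..k}" using j by auto
  have f: "finite (s 1)" "s 1 \<noteq> {}" using pl 1 by (auto simp: plegma_def Fpow_def)
  then have c: "1 \<in> {1..card (s 1)}" by (simp add: card_gt_0_iff Suc_le_eq)
  note e = rank_elt[OF f(1) c]
  show ?thesis
  proof (cases "j = 1")
    case True
    then have "enumerate (s 1) 0 \<le> x"
      using x unfolding enumerate_0 by (simp add: Least_le)
    then show ?thesis by (simp add: elt_def)
  next
    case False
    then show ?thesis
      using plegma_lex[OF pl 1 j e(1) x] e(2) j by (cases "rank (s j) x") auto
  qed
qed

text \<open>
  Suppose the tuples agree below \<open>n\<close> and \<open>n\<close> belongs to \<open>s i\<close> but not to \<open>t i\<close>. By
  thinness \<open>t i\<close> is not exhausted below \<open>n\<close>, so it has a later element at the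
  rank that \<open>n\<close> has in \<open>s i\<close>. Hence \<open>n\<close> is in the union of \<open>t\<close> as well, say in
  \<open>t j\<close> with \<open>j \<noteq> i\<close>, and symmetrically \<open>s j\<close> has a later element at the rank
  of \<open>n\<close> in \<open>t j\<close>. The tuple \<open>s\<close> then puts the slot in the \<open>i\<close>-th set before the
  slot in the \<open>j\<close>-th set, and the tuple \<open>t\<close> does the reverse.
\<close>

lemma plegma_union_step:
  assumes F: "thin F"
    and s: "s \<in> Plm k F" and t: "t \<in> Plm k F"
    and ints: "init_seg (\<Union>j\<in>{1..k}. s j) A" and intt: "init_seg (\<Union>j\<in>{1..k}. t j) A"
    and i: "i \<in> {1..k}" and n: "n \<in> s i"
    and IH: "\<And>m j. m < n \<Longrightarrow> j \<in> {1..k} \<Longrightarrow> m \<in> s j \<longleftrightarrow> m \<in> t j"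
  shows "n \<in> t i"
proof (rule ccontr)
  assume nt: "n \<notin> t i"
  have sF: "s j \<in> F" "plegma k s" if "j \<in> {1..k}" for j using s that by (auto simp: Plm_def)
  have tF: "t j \<in> F" "plegma k t" if "j \<in> {1..k}" for j using t that by (auto simp: Plm_def)
  have same: "s j \<inter> {..<n} = t j \<inter> {..<n}" if "j \<in> {1..k}" for j using IH that by auto
  \<comment> \<open>stated for \<open>u\<close>, \<open>v\<close> because it is used with the roles of \<open>s\<close> and \<open>t\<close> in both orders\<close>
  have ex: "\<exists>m\<in>v j. n < m \<and> rank (v j) m = rank (u j) n"
    if "u \<in> Plm k F" "v \<in> Plm k F" "j \<in> {1..k}" "n \<in> u j" "n \<notin> v j"
      "u j \<inter> {..<n} = v j \<inter> {..<n}" for u v j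
  proof -
    have ex: "\<exists>m. m \<in> v j \<and> n < m"
    proof (rule ccontr)
      assume "\<not> (\<exists>m. m \<in> v j \<and> n < m)"
      then have "v j \<subseteq> {..<n}" using that(5) by (metis lessThan_iff linorder_neqE_nat subsetI)
      then have v: "v j = u j \<inter> {..<n}" using that(6) by auto
      then have "init_seg (v j) (u j)" unfolding init_seg_def by auto
      moreover have "u j \<in> F" "v j \<in> F" using that(1-3) by (auto simp: Plm_def)
      ultimately have "v j = u j" using F unfolding thin_def by blast
      then show False using that by blast
    qed
    define m where "m = (LEAST m. m \<in> v j \<and> n < m)"
    have m: "m \<in> v j" "n < m" using LeastI_ex[OF ex] unfolding m_def by auto
    have "x < n" if "x \<in> v j" "x < m" for x
      using that not_less_Least[of x "\<lambda>m. m \<in> v j \<and> n < m"] \<open>n \<notin> v j\<close>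
      unfolding m_def by (metis linorder_neqE_nat)
    then have "v j \<inter> {..<m} = v j \<inter> {..<n}" using m by auto
    then show ?thesis using m that(6) unfolding rank_def by auto
  qed
  obtain m where m: "m \<in> t i" "n < m" "rank (t i) m = rank (s i) n"
    using ex[OF s t i n nt same[OF i]] by blast
  have "n \<in> A" using ints n i unfolding init_seg_def by blast
  then have "n \<in> (\<Union>j\<in>{1..k}. t j)"
    using intt m i unfolding init_seg_def by (metis UN_I less_imp_le)
  then obtain j where j: "j \<in> {1..k}" "n \<in> t j" by blast
  have ij: "i \<noteq> j" using j nt by blast
  then have ns: "n \<notin> s j" using plegma_disjoint[OF sF(2)[OF i] i j(1) n] by blast
  obtain m' where m': "m' \<in> s j" "n < m'" "rank (s j) m' = rank (t j) n"
    using ex[OF t s j ns same[OF j(1), symmetric]] by blast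
  have "\<not> m' < n" "\<not> m < n" using m' m by auto
  then have "\<not> (rank (t j) n < rank (s i) n \<or> rank (t j) n = rank (s i) n \<and> j < i)"
    "\<not> (rank (s i) n < rank (t j) n \<or> rank (s i) n = rank (t j) n \<and> i < j)"
    using plegma_lex[OF sF(2)[OF i] j(1) i m'(1) n] plegma_lex[OF tF(2)[OF i] i j(1) m(1) j(2)]
      m(3) m'(3) by auto
  then show False using ij by linarith
qed

lemma plegma_union_determines:
  assumes F: "thin F"
    and s: "s \<in> Plm k F" and t: "t \<in> Plm k F"
    and ints: "init_seg (\<Union>j\<in>{1..k}. s j) A" and intt: "init_seg (\<Union>j\<in>{1..k}. t j) A"
  shows "s = t"
proof -
  have "\<forall>j\<in>{1..k}. n \<in> s j \<longleftrightarrow> n \<in> t j" for n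
  proof (induction n rule: less_induct)
    case (less n)
    then have IH: "m \<in> s j \<longleftrightarrow> m \<in> t j" if "m < n" "j \<in> {1..k}" for m j using that by blast
    show ?case
      using plegma_union_step[OF F s t ints intt _ _ IH]
        plegma_union_step[OF F t s intt ints _ _ IH[symmetric]] by blast
  qed
  then have "s j = t j" if "j \<in> {1..k}" for j using that by blast
  then show "s = t" using s t unfolding Plm_def by (blast intro: PiE_ext)
qed

section \<open>The Ramsey theorem for plegma tuples\<close>

lemma restrict_family_mono: "A \<subseteq> B \<Longrightarrow> restrict_family F A \<subseteq> restrict_family F B"
  unfolding restrict_family_def Fpow_def by blast

lemma Plm_mono: "F \<subseteq> G \<Longrightarrow> Plm k F \<subseteq> Plm k G"
  unfolding Plm_def by (auto simp: PiE_iff)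

lemma Plm_restrict_mono: "A \<subseteq> B \<Longrightarrow> Plm k (restrict_family F A) \<subseteq> Plm k (restrict_family F B)"
  by (intro Plm_mono restrict_family_mono)

lemma Plm_restrict_iff:
  "s \<in> Plm k (restrict_family F A) \<longleftrightarrow> s \<in> Plm k F \<and> (\<Union>j\<in>{1..k}. s j) \<subseteq> A"
  unfolding Plm_def restrict_family_def plegma_def by (auto simp: PiE_iff Fpow_def)

text \<open>
  Galvin's dichotomy for the unions of the tuples in \<open>S\<close>. If every infinite subset of \<open>L\<close>
  starts with such a union, then so does the union of a given tuple \<open>t\<close> in \<open>L\<close> prolonged
  inside \<open>L\<close>, and the tuple in \<open>S\<close> found this way must be \<open>t\<close>.
\<close>

lemma dense_open_plegma_homogeneous:
  assumes F: "thin F"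
  shows "dense_open (\<lambda>A. Plm k (restrict_family F A) \<inter> S = {} \<or> Plm k (restrict_family F A) \<subseteq> S)"
proof (rule dense_openI)
  fix A B
  assume "B \<subseteq> A"
    and "Plm k (restrict_family F A) \<inter> S = {} \<or> Plm k (restrict_family F A) \<subseteq> S"
  then show "Plm k (restrict_family F B) \<inter> S = {} \<or> Plm k (restrict_family F B) \<subseteq> S"
    using Plm_restrict_mono[of B A k F] by blast
next
  fix A :: "nat set" assume A: "infinite A"
  define G where "G = (\<lambda>s. \<Union>j\<in>{1..k}. s j) ` (Plm k F \<inter> S)"
  have fin: "finite (\<Union>j\<in>{1..k}. s j)" if "s \<in> Plm k F" for s
    using that by (auto simp: Plm_def plegma_def Fpow_def)
  obtain L where L: "L \<subseteq> A" "infinite L"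
    and G: "(\<forall>s\<in>G. finite s \<longrightarrow> \<not> s \<subseteq> L) \<or> (\<forall>A\<subseteq>L. infinite A \<longrightarrow> (\<exists>s\<in>G. init_seg s A))"
    by (rule galvin_dichotomy[OF A])
  from G have "Plm k (restrict_family F L) \<inter> S = {} \<or> Plm k (restrict_family F L) \<subseteq> S"
  proof
    assume none: "\<forall>s\<in>G. finite s \<longrightarrow> \<not> s \<subseteq> L"
    have "s \<notin> S" if "s \<in> Plm k (restrict_family F L)" for s
    proof
      assume "s \<in> S"
      then show False using that none fin[of s] unfolding G_def Plm_restrict_iff by blast
    qed
    then show ?thesis by blast
  next
    assume all: "\<forall>A\<subseteq>L. infinite A \<longrightarrow> (\<exists>s\<in>G. init_seg s A)"
    have "t \<in> S" if t: "t \<in> Plm k (restrict_family F L)" for t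
    proof -
      define U where "U = (\<Union>j\<in>{1..k}. t j)"
      have tF: "t \<in> Plm k F" "U \<subseteq> L" using t unfolding Plm_restrict_iff U_def by auto
      have finU: "finite U" unfolding U_def using fin tF by blast
      define B where "B = U \<union> (L \<inter> {Max (insert 0 U)<..})"
      have "init_seg U B"
        unfolding init_seg_def B_def using finU by (auto simp: not_less[symmetric] dest: leD)
      moreover have "B \<subseteq> L" "infinite B"
        unfolding B_def using tF infinite_Int_greaterThan[OF L(2)] by auto
      then obtain s where s: "s \<in> Plm k F" "s \<in> S" "init_seg (\<Union>j\<in>{1..k}. s j) B"
        using all unfolding G_def by blast
      ultimately have "s = t"
        using plegma_union_determines[OF F s(1) tF(1) s(3)] unfolding U_def by blast
      then show "t \<in> S" using s by blast
    qed
    then show ?thesis by blast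
  qed
  then show "\<exists>B\<subseteq>A. infinite B \<and>
      (Plm k (restrict_family F B) \<inter> S = {} \<or> Plm k (restrict_family F B) \<subseteq> S)"
    using L by blast
qed

text \<open>A bounded function is coloured by the interval of length \<open>\<epsilon>\<close> that contains its value.\<close>

lemma dense_open_plegma_oscillation:
  fixes f :: "(nat \<Rightarrow> nat set) \<Rightarrow> real"
  assumes F: "thin F" and bd: "bounded (f ` Plm k F)" and e: "\<epsilon> > 0"
  shows "dense_open (\<lambda>A. \<forall>s\<in>Plm k (restrict_family F A). \<forall>t\<in>Plm k (restrict_family F A).
           \<bar>f s - f t\<bar> \<le> \<epsilon>)"
proof -
  define c where "c = (\<lambda>s. \<lfloor>f s / \<epsilon>\<rfloor>)"
  obtain R where R: "\<And>s. s \<in> Plm k F \<Longrightarrow> \<bar>f s\<bar> \<le> R"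
    using bd unfolding bounded_real by auto
  define C where "C = {\<lfloor>- R / \<epsilon>\<rfloor>..\<lfloor>R / \<epsilon>\<rfloor>}"
  have cC: "c s \<in> C" if "s \<in> Plm k F" for s
  proof -
    have "- R \<le> f s" "f s \<le> R" using R[OF that] by auto
    then have "(- R) / \<epsilon> \<le> f s / \<epsilon>" "f s / \<epsilon> \<le> R / \<epsilon>"
      using e divide_right_mono[of "- R" "f s" \<epsilon>] divide_right_mono[of "f s" R \<epsilon>] by linarith+
    then show ?thesis unfolding c_def C_def using floor_mono by auto
  qed
  let ?H = "\<lambda>A. \<forall>i\<in>C. Plm k (restrict_family F A) \<inter> {s. c s = i} = {} \<or>
                  Plm k (restrict_family F A) \<subseteq> {s. c s = i}"
  have H: "dense_open ?H"
    by (rule dense_open_finite_Ball) (auto simp: C_def intro: dense_open_plegma_homogeneous[OF F])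
  have osc: "\<bar>f s - f t\<bar> \<le> \<epsilon>"
    if A: "?H A" and s: "s \<in> Plm k (restrict_family F A)" and t: "t \<in> Plm k (restrict_family F A)"
    for A s t
  proof -
    have "c s \<in> C" using s cC Plm_restrict_iff by blast
    then have "c t = c s" using A s t by blast
    then have "\<bar>f s / \<epsilon> - f t / \<epsilon>\<bar> < 1" unfolding c_def by linarith
    then have "\<bar>f s - f t\<bar> / \<epsilon> < 1" using e by (simp flip: diff_divide_distrib)
    then show ?thesis using e by simp
  qed
  show ?thesis
  proof (rule dense_openI)
    fix A B
    assume "B \<subseteq> A" "\<forall>s\<in>Plm k (restrict_family F A). \<forall>t\<in>Plm k (restrict_family F A).
           \<bar>f s - f t\<bar> \<le> \<epsilon>"
    then show "\<forall>s\<in>Plm k (restrict_family F B). \<forall>t\<in>Plm k (restrict_family F B).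
           \<bar>f s - f t\<bar> \<le> \<epsilon>"
      using Plm_restrict_mono[of B A k F] by blast
  next
    fix A :: "nat set" assume "infinite A"
    then obtain B where "B \<subseteq> A" "infinite B" "?H B" by (rule dense_open_ex[OF H])
    then show "\<exists>B\<subseteq>A. infinite B \<and> (\<forall>s\<in>Plm k (restrict_family F B).
        \<forall>t\<in>Plm k (restrict_family F B). \<bar>f s - f t\<bar> \<le> \<epsilon>)"
      using osc by blast
  qed
qed

section \<open>Stabilising the norms of linear combinations\<close>

definition stable :: "nat set set \<Rightarrow> (nat set \<Rightarrow> 'a::real_normed_vector) \<Rightarrow> nat \<Rightarrow> real \<Rightarrow> nat set \<Rightarrow> bool" where
  "stable F x k \<epsilon> A \<longleftrightarrow>
     (\<forall>s\<in>Plm k (restrict_family F A). \<forall>t\<in>Plm k (restrict_family F A).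
        \<forall>a::nat \<Rightarrow> real. (\<forall>j\<in>{1..k}. a j \<in> {-1..1}) \<longrightarrow>
          \<bar>norm (\<Sum>j=1..k. a j *\<^sub>R x (s j)) - norm (\<Sum>j=1..k. a j *\<^sub>R x (t j))\<bar> \<le> \<epsilon>)"

lemma stableD:
  assumes "stable F x k \<epsilon> A" "s \<in> Plm k (restrict_family F A)" "t \<in> Plm k (restrict_family F A)"
    and "\<And>j. j \<in> {1..k} \<Longrightarrow> \<bar>a j\<bar> \<le> 1"
  shows "\<bar>norm (\<Sum>j=1..k. a j *\<^sub>R x (s j)) - norm (\<Sum>j=1..k. a j *\<^sub>R x (t j))\<bar> \<le> \<epsilon>"
proof -
  have "\<forall>j\<in>{1..k}. a j \<in> {-1..1}" using assms(4) by (auto simp: abs_le_iff minus_le_iff)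
  then show ?thesis using assms(1-3) unfolding stable_def by blast
qed

lemma norm_combination_lipschitz:
  fixes y :: "nat \<Rightarrow> 'a::real_normed_vector"
  assumes "\<And>j. j \<in> {1..k} \<Longrightarrow> norm (y j) \<le> C" "\<And>j. j \<in> {1..k} \<Longrightarrow> \<bar>a j - b j\<bar> \<le> d"
  shows "\<bar>norm (\<Sum>j=1..k. a j *\<^sub>R y j) - norm (\<Sum>j=1..k. b j *\<^sub>R y j)\<bar> \<le> real k * (d * C)"
proof -
  have "\<bar>norm (\<Sum>j=1..k. a j *\<^sub>R y j) - norm (\<Sum>j=1..k. b j *\<^sub>R y j)\<bar>
      \<le> norm ((\<Sum>j=1..k. a j *\<^sub>R y j) - (\<Sum>j=1..k. b j *\<^sub>R y j))"
    by (rule norm_triangle_ineq3)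
  also have "\<dots> = norm (\<Sum>j=1..k. (a j - b j) *\<^sub>R y j)"
    by (simp add: sum_subtractf scaleR_diff_left)
  also have "\<dots> \<le> (\<Sum>j=1..k. d * C)"
  proof (rule sum_norm_le)
    fix j assume j: "j \<in> {1..k}"
    have "0 \<le> d" using assms(2)[OF j] by linarith
    then show "norm ((a j - b j) *\<^sub>R y j) \<le> d * C"
      using assms(1)[OF j] assms(2)[OF j] by (auto intro: mult_mono)
  qed
  finally show ?thesis by simp
qed

text \<open>
  The coefficients range over an infinite set, but the norm is Lipschitz in them with a constant
  common to all tuples; so it suffices to stabilise the norms for the coefficients in a finite grid.
\<close>

lemma dense_open_stable:
  fixes x :: "nat set \<Rightarrow> 'a::real_normed_vector"
  assumes F: "thin F" and bd: "bounded (x ` F)" and e: "\<epsilon> > 0"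
  shows "dense_open (stable F x k \<epsilon>)"
proof -
  obtain C where C: "C > 0" "\<And>s. s \<in> F \<Longrightarrow> norm (x s) \<le> C"
    using bd unfolding bounded_pos by auto
  have xC: "norm (x (s j)) \<le> C" if "s \<in> Plm k F" "j \<in> {1..k}" for s j
    using that by (auto simp: Plm_def intro: C)
  obtain n :: nat where n: "n > 0" "real k * C / n < \<epsilon> / 3"
  proof -
    obtain n :: nat where n: "real k * C / (\<epsilon> / 3) < n" using reals_Archimedean2 by blast
    moreover have "0 \<le> real k * C / (\<epsilon> / 3)" using C e by simp
    ultimately have "n > 0" by linarith
    moreover from this have "real k * C / n < \<epsilon> / 3" using n e by (simp add: field_simps)
    ultimately show thesis by (rule that)
  qed
  define D where "D = (\<lambda>i::int. real_of_int i / n) ` {- int n..int n}"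
  define B where "B = {1..k} \<rightarrow>\<^sub>E D"
  have finB: "finite B" unfolding B_def D_def by (intro finite_PiE) auto
  define f where "f = (\<lambda>(b::nat \<Rightarrow> real) s. norm (\<Sum>j=1..k. b j *\<^sub>R x (s j)))"
  have f_bd: "bounded (f b ` Plm k F)" for b
    unfolding bounded_real
  proof (intro exI ballI)
    fix r assume "r \<in> f b ` Plm k F"
    then obtain s where s: "s \<in> Plm k F" "r = f b s" by blast
    have "norm (\<Sum>j=1..k. b j *\<^sub>R x (s j)) \<le> (\<Sum>j=1..k. \<bar>b j\<bar> * C)"
      by (rule sum_norm_le) (simp add: xC[OF s(1)] mult_left_mono)
    then show "\<bar>r\<bar> \<le> (\<Sum>j=1..k. \<bar>b j\<bar> * C)" unfolding s f_def by simp
  qed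
  let ?H = "\<lambda>A. \<forall>b\<in>B. \<forall>s\<in>Plm k (restrict_family F A). \<forall>t\<in>Plm k (restrict_family F A).
              \<bar>f b s - f b t\<bar> \<le> \<epsilon> / 3"
  have H: "dense_open ?H"
    by (intro dense_open_finite_Ball finB dense_open_plegma_oscillation F f_bd) (use e in auto)
  have stab: "stable F x k \<epsilon> A" if A: "?H A" for A
    unfolding stable_def
  proof (intro ballI allI impI)
    fix s t and a :: "nat \<Rightarrow> real"
    assume s: "s \<in> Plm k (restrict_family F A)" and t: "t \<in> Plm k (restrict_family F A)"
      and a: "\<forall>j\<in>{1..k}. a j \<in> {-1..1}"
    define b where "b = (\<lambda>j\<in>{1..k}. real_of_int \<lfloor>a j * n\<rfloor> / n)"
    have ab: "\<bar>a j - b j\<bar> \<le> 1 / n" if "j \<in> {1..k}" for j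
    proof -
      have "\<bar>a j * n - \<lfloor>a j * n\<rfloor>\<bar> \<le> 1" by linarith
      then have "\<bar>a j * n - \<lfloor>a j * n\<rfloor>\<bar> / n \<le> 1 / n" by (rule divide_right_mono) simp
      also have "\<bar>a j * n - \<lfloor>a j * n\<rfloor>\<bar> / n = \<bar>(a j * n - \<lfloor>a j * n\<rfloor>) / n\<bar>" by simp
      also have "(a j * n - \<lfloor>a j * n\<rfloor>) / n = a j - b j"
        using n that by (simp add: b_def diff_divide_distrib)
      finally show ?thesis .
    qed
    have "b \<in> B"
      unfolding B_def
    proof
      fix j assume j: "j \<in> {1..k}"
      have "a j * n \<le> 1 * n" "(-1) * n \<le> a j * n" 
        using a j mult_right_mono[of "a j" 1 "real n"] mult_right_mono[of "-1" "a j" "real n"]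
        by auto
      then have "\<lfloor>a j * n\<rfloor> \<in> {- int n..int n}" by (auto simp: le_floor_iff floor_le_iff)
      then show "b j \<in> D" using j unfolding b_def D_def by auto
    qed (auto simp: b_def)
    then have 1: "\<bar>f b s - f b t\<bar> \<le> \<epsilon> / 3" using A s t by blast
    have 2: "\<bar>f a r - f b r\<bar> \<le> \<epsilon> / 3" if "r \<in> Plm k F" for r
    proof -
      have "\<bar>f a r - f b r\<bar> \<le> real k * (1 / n * C)"
        unfolding f_def by (rule norm_combination_lipschitz) (use xC[OF that] ab in auto)
      also have "real k * (1 / n * C) = real k * C / n" by simp
      finally show ?thesis using n(2) by linarith
    qed
    have "s \<in> Plm k F" "t \<in> Plm k F" using s t Plm_restrict_iff by blast+
    then have "\<bar>f a s - f a t\<bar> \<le> \<epsilon>" using 1 2[of s] 2[of t] by linarith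
    then show "\<bar>norm (\<Sum>j=1..k. a j *\<^sub>R x (s j)) - norm (\<Sum>j=1..k. a j *\<^sub>R x (t j))\<bar> \<le> \<epsilon>"
      unfolding f_def .
  qed
  show ?thesis
  proof (rule dense_openI)
    fix A B assume "B \<subseteq> A" "stable F x k \<epsilon> A"
    then show "stable F x k \<epsilon> B"
      using Plm_restrict_mono[of B A k F] unfolding stable_def by blast
  next
    fix A :: "nat set" assume "infinite A"
    then obtain B where "B \<subseteq> A" "infinite B" "?H B" by (rule dense_open_ex[OF H])
    then show "\<exists>B\<subseteq>A. infinite B \<and> stable F x k \<epsilon> B" using stab by blast
  qed
qed

text \<open>
  Here the property is indexed by the position of an element rather than by its value. Since the
  element preceding position \<open>n\<close> is at least \<open>n - 1\<close>, the diagonal set for the properties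
  \<open>Q 0, \<dots>, Q (Suc m)\<close> at each element \<open>m\<close> does the job.
\<close>

lemma dense_open_diagonal_tail:
  assumes Q: "\<And>n. dense_open (Q n)" and A: "infinite A"
  obtains M where "M \<subseteq> A" "infinite M" "\<And>n. Q n (M \<inter> {enumerate M n..})"
proof -
  obtain A' where A': "A' \<subseteq> A" "infinite A'" "Q 0 A'" by (rule dense_open_ex[OF Q A])
  have "dense_open (\<lambda>A. \<forall>m\<in>{..Suc n}. Q m A)" for n
    by (rule dense_open_finite_Ball) (auto intro: Q)
  then obtain M where M: "M \<subseteq> A'" "infinite M"
    and diag: "\<And>n. n \<in> M \<Longrightarrow> \<forall>m\<in>{..Suc n}. Q m (M \<inter> {n<..})"
    using dense_open_diagonal[of "\<lambda>n A. \<forall>m\<in>{..Suc n}. Q m A", OF _ A'(2)] by blast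
  have inf: "infinite (M \<inter> {enumerate M n..})" for n
  proof -
    have "M \<inter> {enumerate M n<..} \<subseteq> M \<inter> {enumerate M n..}" by auto
    then show ?thesis using infinite_Int_greaterThan[OF M(2)] finite_subset by blast
  qed
  have "Q n (M \<inter> {enumerate M n..})" for n
  proof (cases n)
    case 0
    then show ?thesis using dense_open_mono[OF Q inf _ A'(3)] M(1) by blast
  next
    case (Suc m)
    have "m \<le> enumerate M m" using M(2) by (rule le_enumerate)
    then have "Q n (M \<inter> {enumerate M m<..})"
      using diag[OF enumerate_in_set[OF M(2)], of m] Suc by auto
    moreover have "enumerate M m < enumerate M n" using Suc M(2) by simp
    then have "M \<inter> {enumerate M n..} \<subseteq> M \<inter> {enumerate M m<..}" by auto
    ultimately show ?thesis using dense_open_mono[OF Q inf] by blast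
  qed
  then show thesis using that[of M] M A' by blast
qed

section \<open>Existence of plegma tuples\<close>

text \<open>
  The \<open>k\<close> residue classes of positions in \<open>L\<close> are interlaced infinite sets. Their initial
  segments in \<open>F\<close>, of whatever lengths, form a plegma tuple.
\<close>

lemma plegma_exists:
  assumes F: "F \<subseteq> Fpow PosNat" "{} \<notin> F" and L: "infinite L"
    and large: "\<And>A. A \<subseteq> L \<Longrightarrow> infinite A \<Longrightarrow> \<exists>s\<in>F. init_seg s A"
  obtains s where "s \<in> Plm k (restrict_family F L)"
proof -
  define h where "h = (\<lambda>j m. enumerate L (m * k + (j - 1)))"
  define A where "A = (\<lambda>j. range (h j))"
  have "\<exists>s\<in>F. init_seg s (A j)" if j: "j \<in> {1..k}" for j
  proof (rule large)
    show "A j \<subseteq> L" unfolding A_def h_def using enumerate_in_set[OF L] by blast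
    have "inj (h j)"
    proof (rule injI)
      fix m m' assume "h j m = h j m'"
      then have "m * k + (j - 1) = m' * k + (j - 1)"
        unfolding h_def by (rule injD[OF inj_enumerate[OF L]])
      then show "m = m'" using j by simp
    qed
    then show "infinite (A j)" unfolding A_def by (rule range_inj_infinite)
  qed
  then obtain s' where s': "\<And>j. j \<in> {1..k} \<Longrightarrow> s' j \<in> F \<and> init_seg (s' j) (A j)" by metis
  define s where "s = restrict s' {1..k}"
  have s: "s j \<in> F" "init_seg (s j) (A j)" if "j \<in> {1..k}" for j
    using s'[OF that] that by (auto simp: s_def)
  have hmono: "h i m < h j m'" if "i \<in> {1..k}" "j \<in> {1..k}" "m < m' \<or> m = m' \<and> i < j" for i j m m'
  proof -
    have "m * k + (i - 1) < m' * k + (j - 1)"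
    proof (cases "m < m'")
      case True
      then have "Suc m * k \<le> m' * k" by (intro mult_right_mono) auto
      moreover have "i - 1 < k" using that by auto
      ultimately show ?thesis by simp
    next
      case False
      then show ?thesis using that by auto
    qed
    then show ?thesis unfolding h_def using L by simp
  qed
  have rank_h: "rank (s j) (h j m) = m" if j: "j \<in> {1..k}" and m: "h j m \<in> s j" for j m
  proof -
    have sm: "strict_mono (h j)" using hmono[OF j j] by (auto simp: strict_mono_def)
    have "s j \<inter> {..<h j m} = A j \<inter> {..<h j m}"
      using s(2)[OF j] m unfolding init_seg_def by (auto intro: less_imp_le)
    also have "\<dots> = h j ` {..<m}"
      unfolding A_def by (auto simp: strict_mono_less[OF sm])
    also have "card (h j ` {..<m}) = m"
      by (subst card_image) (simp_all add: inj_on_def strict_mono_eq[OF sm])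
    finally show ?thesis unfolding rank_def .
  qed
  have "plegma k s"
    unfolding plegma_iff_lex
  proof (intro conjI ballI impI)
    fix i j x y
    assume ij: "i \<in> {1..k}" "j \<in> {1..k}" and x: "x \<in> s i" and y: "y \<in> s j"
      and lex: "rank (s i) x < rank (s j) y \<or> rank (s i) x = rank (s j) y \<and> i < j"
    obtain m where m: "x = h i m" using s(2)[OF ij(1)] x unfolding init_seg_def A_def by blast
    obtain m' where m': "y = h j m'" using s(2)[OF ij(2)] y unfolding init_seg_def A_def by blast
    show "x < y"
      using hmono[OF ij, of m m'] lex rank_h[OF ij(1)] rank_h[OF ij(2)] x y m m' by simp
  next
    fix j assume "j \<in> {1..k}"
    then have "s j \<in> F" by (rule s(1))
    then show "s j \<in> Fpow PosNat" "s j \<noteq> {}" using F by auto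
  qed
  moreover have "s \<in> {1..k} \<rightarrow>\<^sub>E F"
    by (rule PiE_I) (use s(1) in blast, unfold s_def restrict_def, rule if_not_P)
  moreover have "s j \<subseteq> L" if "j \<in> {1..k}" for j
  proof -
    have "s j \<subseteq> A j" using s(2)[OF that] by (simp add: init_seg_def)
    also have "A j \<subseteq> L" unfolding A_def h_def using enumerate_in_set[OF L] by (intro image_subsetI)
    finally show ?thesis .
  qed
  then have "(\<Union>j\<in>{1..k}. s j) \<subseteq> L" by (rule UN_least)
  ultimately have "s \<in> Plm k (restrict_family F L)"
    unfolding Plm_restrict_iff unfolding Plm_def mem_Collect_eq by (intro conjI)
  then show thesis by (rule that)
qed

section \<open>The unit vector basis of the finitely supported sequences\<close>

lemma lookup_scaleR:
  "Poly_Mapping.lookup (r *\<^sub>R v) i = r *\<^sub>R Poly_Mapping.lookup v i"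
proof -
  have "{j. r *\<^sub>R Poly_Mapping.lookup v j \<noteq> 0} \<subseteq> Poly_Mapping.keys v"
    by (auto simp: in_keys_iff)
  then have "finite {j. r *\<^sub>R Poly_Mapping.lookup v j \<noteq> 0}"
    by (rule finite_subset) simp
  then show ?thesis unfolding scaleR_poly_mapping_def by simp
qed

lemma lookup_sum_unit_vectors:
  assumes "finite T"
  shows "Poly_Mapping.lookup (\<Sum>j\<in>T. c j *\<^sub>R Poly_Mapping.single j (1::real)) i = (if i \<in> T then c i else 0)"
proof -
  have "Poly_Mapping.lookup (\<Sum>j\<in>T. c j *\<^sub>R Poly_Mapping.single j (1::real)) i = (\<Sum>j\<in>T. if j = i then c j else 0)"
    unfolding Poly_Mapping.lookup_sum
    by (rule sum.cong) (auto simp: lookup_scaleR lookup_single when_def)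
  then show ?thesis using assms by simp
qed

text \<open>The shift by one matches bases indexed from 1 with coordinates indexed from 0.\<close>

lemma hamel_basis_unit_vectors:
  "hamel_basis (\<lambda>n. Poly_Mapping.single (n - 1) (1::real) :: nat \<Rightarrow>\<^sub>0 real)"
proof -
  define u :: "nat \<Rightarrow> nat \<Rightarrow>\<^sub>0 real" where "u = (\<lambda>i. Poly_Mapping.single i 1)"
  have inj: "inj u"
    unfolding u_def by (rule injI) (metis lookup_single_eq lookup_single_not_eq zero_neq_one)
  have range: "(\<lambda>n. Poly_Mapping.single (n - 1) (1::real)) ` PosNat = range u"
  proof
    show "range u \<subseteq> (\<lambda>n. Poly_Mapping.single (n - 1) (1::real)) ` PosNat"
    proof
      fix v assume "v \<in> range u"
      then obtain i where "v = u i" by blast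
      then have "v = Poly_Mapping.single (Suc i - 1) 1" "Suc i \<in> PosNat" by (auto simp: u_def)
      then show "v \<in> (\<lambda>n. Poly_Mapping.single (n - 1) (1::real)) ` PosNat" by blast
    qed
  qed (auto simp: u_def)
  have "independent (range u)"
    unfolding independent_explicit_module
  proof (intro allI impI)
    fix T c v
    assume T: "finite T" "T \<subseteq> range u" "(\<Sum>v\<in>T. c v *\<^sub>R v) = 0" "v \<in> T"
    define I where "I = u -` T"
    have TI: "T = u ` I" using T(2) unfolding I_def by blast
    have finI: "finite I" unfolding I_def using T(1) inj by (rule finite_vimageI)
    obtain i where i: "v = u i" "i \<in> I" using T(4) TI by blast
    have "(\<Sum>v\<in>T. c v *\<^sub>R v) = (\<Sum>i\<in>I. c (u i) *\<^sub>R u i)"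
      unfolding TI by (subst sum.reindex) (auto intro: inj_on_subset[OF inj])
    then have "Poly_Mapping.lookup (\<Sum>i\<in>I. c (u i) *\<^sub>R Poly_Mapping.single i (1::real)) i = 0"
      using T(3) by (simp add: u_def)
    then show "c v = 0" using i by (simp add: lookup_sum_unit_vectors[OF finI])
  qed
  moreover have "v \<in> span (range u)" for v
  proof -
    have "v = (\<Sum>i\<in>Poly_Mapping.keys v. Poly_Mapping.lookup v i *\<^sub>R u i)"
      unfolding u_def by (rule poly_mapping_eqI) (simp add: lookup_sum_unit_vectors in_keys_iff)
    moreover have "(\<Sum>i\<in>Poly_Mapping.keys v. Poly_Mapping.lookup v i *\<^sub>R u i) \<in> span (range u)"
      by (intro span_sum span_scale span_base) auto
    ultimately show ?thesis by metis
  qed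
  moreover have "inj_on (\<lambda>n. Poly_Mapping.single (n - 1) (1::real) :: nat \<Rightarrow>\<^sub>0 real) PosNat"
  proof (rule inj_onI)
    fix m n :: nat
    assume "m \<in> PosNat" "n \<in> PosNat"
      "Poly_Mapping.single (m - 1) (1::real) = Poly_Mapping.single (n - 1) 1"
    moreover from this have "m - 1 = n - 1" using injD[OF inj, of "m - 1" "n - 1"] by (simp add: u_def)
    ultimately show "m = n" by auto
  qed
  ultimately show ?thesis unfolding hamel_basis_def range by auto
qed

section \<open>The spreading model as a limit\<close>

lemma seminorm_lim:
  assumes g: "\<And>l. seminorm (g l)" and lim: "\<And>v. (\<lambda>l. g l v) \<longlonglongrightarrow> p v"
  shows "seminorm p"
  unfolding seminorm_def
proof (intro conjI allI)
  fix v w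
  show "p (v + w) \<le> p v + p w"
    by (rule LIMSEQ_le[OF lim tendsto_add[OF lim lim]]) (use g in \<open>auto simp: seminorm_def\<close>)
next
  fix c :: real and v
  have "(\<lambda>l. g l (c *\<^sub>R v)) \<longlonglongrightarrow> \<bar>c\<bar> * p v"
    using tendsto_mult_left[OF lim, of "\<bar>c\<bar>" v] g by (simp add: seminorm_def)
  then show "p (c *\<^sub>R v) = \<bar>c\<bar> * p v" using LIMSEQ_unique lim by blast
qed

lemma Plm_restrict_prefix:
  assumes "s \<in> Plm l F" "k \<le> l"
  shows "restrict s {1..k} \<in> Plm k F"
proof -
  have s: "s \<in> {1..l} \<rightarrow>\<^sub>E F" "plegma l s" and sub: "{1..k} \<subseteq> {1..l}"
    using assms unfolding Plm_def by auto
  have "plegma k (restrict s {1..k})"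
    unfolding plegma_iff_lex
  proof (intro conjI ballI impI)
    fix i j x y
    assume ij: "i \<in> {1..k}" "j \<in> {1..k}" and xy: "x \<in> restrict s {1..k} i" "y \<in> restrict s {1..k} j"
      and lex: "rank (restrict s {1..k} i) x < rank (restrict s {1..k} j) y \<or>
        rank (restrict s {1..k} i) x = rank (restrict s {1..k} j) y \<and> i < j"
    show "x < y"
      by (rule plegma_lex[OF s(2), of i j]) (use ij xy lex assms(2) in auto)
  next
    fix j assume j: "j \<in> {1..k}"
    then have "j \<in> {1..l}" using sub by blast
    then show "restrict s {1..k} j \<in> Fpow PosNat" "restrict s {1..k} j \<noteq> {}"
      using s(2) j unfolding plegma_def by auto
  qed
  moreover have "restrict s {1..k} \<in> {1..k} \<rightarrow>\<^sub>E F"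
    using s(1) sub by (auto simp: PiE_iff)
  ultimately show ?thesis unfolding Plm_def by blast
qed

text \<open>
  The seminorm is the limit of the norms along tuples \<open>\<sigma> n\<close> of growing length chosen in the
  tails of \<open>M\<close>. For a vector supported on the first \<open>k\<close> coordinates only the first \<open>k\<close> sets of
  \<open>\<sigma> n\<close> count, and they form a plegma tuple in the same tail. Stability then compares
  these norms with one another, which gives convergence, and with the norm at any other tuple in
  the tail, which gives the estimate for the limit. Vectors with coefficients outside
  \<open>[-1, 1]\<close> are handled by scaling.
\<close>

lemma generates_from_stable:
  fixes x :: "nat set \<Rightarrow> 'a::real_normed_vector"
  assumes M: "infinite M"
    and stab: "\<And>n k. k \<le> Suc n \<Longrightarrow> stable F x k (1 / Suc n) (M \<inter> {enumerate M n..})"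
    and ex: "\<And>n. \<exists>s. s \<in> Plm (Suc n) (restrict_family F (M \<inter> {enumerate M n..}))"
  shows "generates_some_spreading_model F x M"
proof -
  define T where "T = (\<lambda>n. M \<inter> {enumerate M n..})"
  define e :: "nat \<Rightarrow> nat \<Rightarrow>\<^sub>0 real" where "e = (\<lambda>n. Poly_Mapping.single (n - 1) 1)"
  obtain \<sigma> where \<sigma>: "\<And>n. \<sigma> n \<in> Plm (Suc n) (restrict_family F (T n))"
    using ex unfolding T_def by metis
  define g where "g = (\<lambda>l v. norm (\<Sum>j=1..Suc l. Poly_Mapping.lookup v (j - 1) *\<^sub>R x (\<sigma> l j)))"
  have stabT: "stable F x k (1 / Suc n) (T n)" if "k \<le> Suc n" for k n
    using stab[OF that] unfolding T_def .
  have T_dec: "T m \<subseteq> T n" if "n \<le> m" for n m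
  proof -
    have "enumerate M n \<le> enumerate M m" using that M by simp
    then show ?thesis unfolding T_def by auto
  qed
  have g_eq: "g l v = norm (\<Sum>j=1..k. Poly_Mapping.lookup v (j - 1) *\<^sub>R x (\<sigma> l j))"
    if "Poly_Mapping.keys v \<subseteq> {..<k}" "k \<le> Suc l" for l k v
  proof -
    have "Poly_Mapping.lookup v (j - 1) = 0" if "j \<in> {1..Suc l} - {1..k}" for j
      using that \<open>Poly_Mapping.keys v \<subseteq> {..<k}\<close> by (force simp: in_keys_iff)
    then show ?thesis
      unfolding g_def using that(2) by (intro arg_cong[where f = norm] sum.mono_neutral_right) auto
  qed
  have close: "\<bar>norm (\<Sum>j=1..k. Poly_Mapping.lookup v (j - 1) *\<^sub>R x (s j)) - g l v\<bar> \<le> 1 / Suc n"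
    if v: "Poly_Mapping.keys v \<subseteq> {..<k}" "\<And>i. \<bar>Poly_Mapping.lookup v i\<bar> \<le> 1"
      and kn: "k \<le> Suc n" "n \<le> l" and s: "s \<in> Plm k (restrict_family F (T n))" for v k n l s
  proof -
    have "\<sigma> l \<in> Plm (Suc l) (restrict_family F (T n))"
      using \<sigma>[of l] Plm_restrict_mono[OF T_dec[OF kn(2)]] by blast
    then have "restrict (\<sigma> l) {1..k} \<in> Plm k (restrict_family F (T n))"
      using kn by (intro Plm_restrict_prefix[of _ "Suc l"]) auto
    from stableD[OF stabT[OF kn(1)] s this, of "\<lambda>j. Poly_Mapping.lookup v (j - 1)"]
    have "\<bar>norm (\<Sum>j=1..k. Poly_Mapping.lookup v (j - 1) *\<^sub>R x (s j)) -
        norm (\<Sum>j=1..k. Poly_Mapping.lookup v (j - 1) *\<^sub>R x (restrict (\<sigma> l) {1..k} j))\<bar> \<le> 1 / Suc n"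
      using v(2) by blast
    moreover have "(\<Sum>j=1..k. Poly_Mapping.lookup v (j - 1) *\<^sub>R x (restrict (\<sigma> l) {1..k} j)) =
        (\<Sum>j=1..k. Poly_Mapping.lookup v (j - 1) *\<^sub>R x (\<sigma> l j))"
      by (intro sum.cong) auto
    ultimately show ?thesis using g_eq[OF v(1)] kn by simp
  qed
  have g_semi: "seminorm (g l)" for l
    unfolding seminorm_def g_def
  proof (intro conjI allI)
    fix v w :: "nat \<Rightarrow>\<^sub>0 real"
    show "norm (\<Sum>j=1..Suc l. Poly_Mapping.lookup (v + w) (j - 1) *\<^sub>R x (\<sigma> l j))
      \<le> norm (\<Sum>j=1..Suc l. Poly_Mapping.lookup v (j - 1) *\<^sub>R x (\<sigma> l j)) +
        norm (\<Sum>j=1..Suc l. Poly_Mapping.lookup w (j - 1) *\<^sub>R x (\<sigma> l j))"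
      unfolding lookup_add scaleR_add_left sum.distrib by (rule norm_triangle_ineq)
  next
    fix c :: real and v :: "nat \<Rightarrow>\<^sub>0 real"
    have "(\<Sum>j=1..Suc l. Poly_Mapping.lookup (c *\<^sub>R v) (j - 1) *\<^sub>R x (\<sigma> l j)) =
        c *\<^sub>R (\<Sum>j=1..Suc l. Poly_Mapping.lookup v (j - 1) *\<^sub>R x (\<sigma> l j))"
      unfolding scaleR_sum_right lookup_scaleR by simp
    then show "norm (\<Sum>j=1..Suc l. Poly_Mapping.lookup (c *\<^sub>R v) (j - 1) *\<^sub>R x (\<sigma> l j)) =
        \<bar>c\<bar> * norm (\<Sum>j=1..Suc l. Poly_Mapping.lookup v (j - 1) *\<^sub>R x (\<sigma> l j))"
      by (simp only: norm_scaleR)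
  qed
  have keys_bound: "\<exists>k. Poly_Mapping.keys v \<subseteq> {..<k}" for v :: "nat \<Rightarrow>\<^sub>0 real"
    using finite_nat_iff_bounded finite_keys by blast
  have conv1: "convergent (\<lambda>l. g l v)" if v: "\<And>i. \<bar>Poly_Mapping.lookup v i\<bar> \<le> 1" for v
  proof -
    obtain k where k: "Poly_Mapping.keys v \<subseteq> {..<k}" using keys_bound by blast
    have "Cauchy (\<lambda>l. g l v)"
      unfolding Cauchy_altdef
    proof (intro allI impI)
      fix r :: real assume "r > 0"
      then obtain n0 where n0: "inverse (real (Suc n0)) < r" using reals_Archimedean by blast
      define n where "n = max n0 k"
      have "1 / real (Suc n) \<le> 1 / real (Suc n0)" by (intro divide_left_mono) (auto simp: n_def)
      then have n: "1 / real (Suc n) < r" using n0 by (simp add: inverse_eq_divide)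
      have "dist (g i v) (g j v) < r" if "n \<le> i" "i < j" for i j
      proof -
        have ki: "k \<le> Suc i" using that(1) unfolding n_def by simp
        have "restrict (\<sigma> i) {1..k} \<in> Plm k (restrict_family F (T n))"
          using Plm_restrict_prefix[OF \<sigma> ki] Plm_restrict_mono[OF T_dec[OF that(1)]] by blast
        from close[OF k v _ _ this, of j] have
          "\<bar>norm (\<Sum>l=1..k. Poly_Mapping.lookup v (l - 1) *\<^sub>R x (restrict (\<sigma> i) {1..k} l)) - g j v\<bar>
             \<le> 1 / Suc n"
          using that unfolding n_def by simp
        moreover have "(\<Sum>l=1..k. Poly_Mapping.lookup v (l - 1) *\<^sub>R x (restrict (\<sigma> i) {1..k} l)) =
            (\<Sum>l=1..k. Poly_Mapping.lookup v (l - 1) *\<^sub>R x (\<sigma> i l))"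
          by (intro sum.cong) auto
        ultimately show ?thesis using g_eq[OF k ki] n by (simp add: dist_real_def)
      qed
      then show "\<exists>N. \<forall>m\<ge>N. \<forall>n>m. dist (g m v) (g n v) < r" by blast
    qed
    then show ?thesis by (simp add: Cauchy_convergent_iff)
  qed
  have conv: "convergent (\<lambda>l. g l v)" for v
  proof -
    define c where "c = 1 + (\<Sum>i\<in>Poly_Mapping.keys v. \<bar>Poly_Mapping.lookup v i\<bar>)"
    have "0 \<le> (\<Sum>i\<in>Poly_Mapping.keys v. \<bar>Poly_Mapping.lookup v i\<bar>)" by (rule sum_nonneg) simp
    then have c: "c \<ge> 1" unfolding c_def by simp
    have "\<bar>Poly_Mapping.lookup v i\<bar> \<le> c" for i
    proof (cases "i \<in> Poly_Mapping.keys v")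
      case True
      then have "\<bar>Poly_Mapping.lookup v i\<bar> \<le> (\<Sum>i\<in>Poly_Mapping.keys v. \<bar>Poly_Mapping.lookup v i\<bar>)"
        by (intro member_le_sum) auto
      then show ?thesis unfolding c_def by simp
    next
      case False
      then show ?thesis using c by (simp add: in_keys_iff)
    qed
    then have "convergent (\<lambda>l. g l ((1 / c) *\<^sub>R v))"
      using c by (intro conv1) (simp add: lookup_scaleR)
    then have "convergent (\<lambda>l. c * g l ((1 / c) *\<^sub>R v))"
      by (rule convergent_mult[OF convergent_const])
    moreover have "c * g l ((1 / c) *\<^sub>R v) = g l v" for l
      using g_semi[of l] c by (simp add: seminorm_def)
    ultimately show ?thesis by simp
  qed
  define p where "p = (\<lambda>v. lim (\<lambda>l. g l v))"
  have lim: "(\<lambda>l. g l v) \<longlonglongrightarrow> p v" for v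
    unfolding p_def using conv by (simp add: convergent_LIMSEQ_iff)
  have "generates F x M p e"
    unfolding generates_def
  proof (intro conjI exI[of _ "\<lambda>l. 1 / Suc (l - 1)"] allI impI)
    show "seminorm p" by (rule seminorm_lim[OF g_semi lim])
    show "hamel_basis e" unfolding e_def by (rule hamel_basis_unit_vectors)
    have "(\<lambda>l. 1 / real (Suc (Suc l - 1))) \<longlonglongrightarrow> 0"
      using LIMSEQ_inverse_real_of_nat by (simp add: inverse_eq_divide)
    then show "(\<lambda>l. 1 / real (Suc (l - 1))) \<longlonglongrightarrow> 0"
      by (subst (asm) filterlim_sequentially_Suc)
  next
    fix l k :: nat and a :: "nat \<Rightarrow> real" and s
    assume as: "1 \<le> k \<and> k \<le> l \<and> (\<forall>j\<in>{1..k}. a j \<in> {- 1..1}) \<and>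
      s \<in> Plm k (restrict_family F M) \<and> elt M l \<le> elt (s 1) 1"
    define v where "v = (\<Sum>j=1..k. a j *\<^sub>R e j)"
    have "v = (\<Sum>i<k. a (Suc i) *\<^sub>R Poly_Mapping.single i (1::real))"
      unfolding v_def e_def by (rule sum.reindex_bij_witness[of _ Suc "\<lambda>j. j - 1"]) auto
    then have look: "Poly_Mapping.lookup v i = (if i < k then a (Suc i) else 0)" for i
      by (simp add: lookup_sum_unit_vectors)
    have keys: "Poly_Mapping.keys v \<subseteq> {..<k}" by (auto simp: in_keys_iff look split: if_splits)
    have v1: "\<bar>Poly_Mapping.lookup v i\<bar> \<le> 1" for i
    proof (cases "i < k")
      case True
      then have "Suc i \<in> {1..k}" by auto
      then have "a (Suc i) \<in> {-1..1}" using as by blast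
      then show ?thesis using True by (simp add: look abs_le_iff)
    qed (simp add: look)
    have pl: "plegma k s" using as by (auto simp: Plm_def)
    have "(\<Union>j\<in>{1..k}. s j) \<subseteq> T (l - 1)"
    proof
      fix y assume y: "y \<in> (\<Union>j\<in>{1..k}. s j)"
      then have "elt (s 1) 1 \<le> y" using plegma_first_least[OF pl] by blast
      moreover have "y \<in> M" using as y Plm_restrict_iff by blast
      ultimately show "y \<in> T (l - 1)" using as unfolding T_def elt_def by simp
    qed
    then have "s \<in> Plm k (restrict_family F (T (l - 1)))"
      using as unfolding Plm_restrict_iff by blast
    then have "\<bar>norm (\<Sum>j=1..k. Poly_Mapping.lookup v (j - 1) *\<^sub>R x (s j)) - g i v\<bar> \<le> 1 / Suc (l - 1)"
      if "l - 1 \<le> i" for i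
      using close[OF keys v1 _ that] as by simp
    then have ev: "\<forall>\<^sub>F i in sequentially.
        \<bar>norm (\<Sum>j=1..k. Poly_Mapping.lookup v (j - 1) *\<^sub>R x (s j)) - g i v\<bar> \<le> 1 / Suc (l - 1)"
      unfolding eventually_sequentially by blast
    have "\<bar>norm (\<Sum>j=1..k. Poly_Mapping.lookup v (j - 1) *\<^sub>R x (s j)) - p v\<bar> \<le> 1 / Suc (l - 1)"
      by (rule tendsto_upperbound[OF _ ev]) (auto intro!: tendsto_intros lim)
    moreover have "(\<Sum>j=1..k. Poly_Mapping.lookup v (j - 1) *\<^sub>R x (s j)) = (\<Sum>j=1..k. a j *\<^sub>R x (s j))"
      by (rule sum.cong) (auto simp: look)
    ultimately show "\<bar>norm (\<Sum>j=1..k. a j *\<^sub>R x (s j)) - p (\<Sum>j=1..k. a j *\<^sub>R e j)\<bar> \<le> 1 / Suc (l - 1)"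
      unfolding v_def by simp
  qed simp
  then show ?thesis unfolding generates_some_spreading_model_def by blast
qed

text \<open>
  After the dichotomy for \<open>F\<close> itself, either \<open>L\<close> contains no plegma tuple of positive length, and
  every seminorm will do, or there are tuples of all lengths in every infinite subset of \<open>L\<close>.
\<close>

theorem thin_family_spreading_model:
  fixes x :: "nat set \<Rightarrow> 'a::real_normed_vector"
  assumes F: "thin F" "F \<subseteq> Fpow PosNat" and bd: "bounded (x ` F)" and N: "infinite N"
  obtains M where "M \<subseteq> N" "infinite M" "generates_some_spreading_model F x M"
proof -
  obtain L where L: "L \<subseteq> N" "infinite L"
    and gal: "(\<forall>s\<in>F. finite s \<longrightarrow> \<not> s \<subseteq> L) \<or> (\<forall>A\<subseteq>L. infinite A \<longrightarrow> (\<exists>s\<in>F. init_seg s A))"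
    by (rule galvin_dichotomy[OF N])
  show thesis
  proof (cases "{} \<in> F \<or> (\<forall>s\<in>F. finite s \<longrightarrow> \<not> s \<subseteq> L)")
    case True
    have no: "s \<notin> Plm k (restrict_family F L)" if "1 \<le> k" for s k
    proof
      assume "s \<in> Plm k (restrict_family F L)"
      then have s1: "s 1 \<in> F" "s 1 \<subseteq> L" "finite (s 1)" "s 1 \<noteq> {}"
        using that by (auto simp: Plm_def plegma_def restrict_family_def Fpow_def PiE_iff)
      moreover have "init_seg {} (s 1)" by (simp add: init_seg_def)
      ultimately show False using True F(1) unfolding thin_def by blast
    qed
    have "generates F x L (\<lambda>_. 0) (\<lambda>n. Poly_Mapping.single (n - 1) (1::real) :: nat \<Rightarrow>\<^sub>0 real)"
      unfolding generates_def
    proof (intro conjI exI[of _ "\<lambda>l. 1 / Suc l"] allI impI)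
      show "seminorm (\<lambda>_::nat \<Rightarrow>\<^sub>0 real. 0)" by (simp add: seminorm_def)
      show "(\<lambda>l. 1 / real (Suc l)) \<longlonglongrightarrow> 0"
        using LIMSEQ_inverse_real_of_nat by (simp add: inverse_eq_divide)
    qed (use no hamel_basis_unit_vectors in auto)
    then show thesis using that L unfolding generates_some_spreading_model_def by blast
  next
    case False
    then have large: "\<exists>s\<in>F. init_seg s A" if "A \<subseteq> L" "infinite A" for A using gal that by blast
    have "dense_open (\<lambda>A. \<forall>k\<in>{..Suc n}. stable F x k (1 / Suc n) A)" for n
      by (intro dense_open_finite_Ball dense_open_stable F bd) auto
    then obtain M where M: "M \<subseteq> L" "infinite M"
      and stab: "\<And>n. \<forall>k\<in>{..Suc n}. stable F x k (1 / Suc n) (M \<inter> {enumerate M n..})"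
      using dense_open_diagonal_tail[of "\<lambda>n A. \<forall>k\<in>{..Suc n}. stable F x k (1 / Suc n) A", OF _ L(2)]
      by blast
    have "generates_some_spreading_model F x M"
    proof (rule generates_from_stable[OF M(2)])
      show "stable F x k (1 / Suc n) (M \<inter> {enumerate M n..})" if "k \<le> Suc n" for k n
        using stab that by blast
      fix n
      have "M \<inter> {enumerate M n<..} \<subseteq> M \<inter> {enumerate M n..}" by auto
      then have inf: "infinite (M \<inter> {enumerate M n..})"
        using infinite_Int_greaterThan[OF M(2)] finite_subset by blast
      have "{} \<notin> F" using False by simp
      then obtain s where "s \<in> Plm (Suc n) (restrict_family F (M \<inter> {enumerate M n..}))"
      proof (rule plegma_exists[OF F(2) _ inf])
        fix A assume "A \<subseteq> M \<inter> {enumerate M n..}" "infinite A"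
        then show "\<exists>s\<in>F. init_seg s A" using large[of A] M(1) by blast
      qed
      then show "\<exists>s. s \<in> Plm (Suc n) (restrict_family F (M \<inter> {enumerate M n..}))" by blast
    qed
    then show thesis using that L M by blast
  qed
qed

theorem theorem4p5:
  fixes F :: "nat set set"
  assumes "regular_thin F"
  shows "(\<forall>x :: nat set \<Rightarrow> 'a::banach. bounded (x ` F) \<longrightarrow> admits_some_spreading_model F x) \<and>
         (\<forall>x :: nat set \<Rightarrow> 'a. \<forall>N\<in>inf_subsets PosNat. bounded (x ` F) \<longrightarrow>
            (\<exists>M\<in>inf_subsets N. generates_some_spreading_model F x M))"
proof -
  have F: "thin F" "F \<subseteq> Fpow PosNat" using assms by (simp_all add: regular_thin_def)
  have sub: "\<exists>M\<in>inf_subsets N. generates_some_spreading_model F x M"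
    if N: "N \<in> inf_subsets PosNat" and bd: "bounded (x ` F)" for x :: "nat set \<Rightarrow> 'a" and N
  proof -
    have "infinite N" using N by (simp add: inf_subsets_def)
    then obtain M where "M \<subseteq> N" "infinite M" "generates_some_spreading_model F x M"
      by (rule thin_family_spreading_model[OF F bd])
    then show ?thesis by (auto simp: inf_subsets_def)
  qed
  have "PosNat \<in> inf_subsets PosNat" by (simp add: inf_subsets_def infinite_Ici)
  then have "admits_some_spreading_model F x" if bd: "bounded (x ` F)" for x :: "nat set \<Rightarrow> 'a"
  proof -
    obtain M where "M \<in> inf_subsets PosNat" "generates_some_spreading_model F x M"
      using sub[OF \<open>PosNat \<in> inf_subsets PosNat\<close> bd] by (rule bexE)
    then show ?thesis
      unfolding admits_some_spreading_model_def generates_some_spreading_model_def admits_def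
      by blast
  qed
  then show ?thesis using sub by blast
qed

end
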